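(* Let $n$ be a positive integer, and identify $R_n$ with $\{0,1,\dots,n-1\}$. Let $\phi\in Z^2_{\rm TQ}(R_n;R_\infty)$ be the cocycle given, for $a,b\in\{0,\dots,n-1\}$, by $$\phi(a,b)=\begin{cases}-1 & \text{if } 2b<a,\\ 0 & \text{if } 2b<n+a \text{ and } a\le 2b,\\ 1 & \text{if } n+a\le 2b,\end{cases}$$ where the inequalities are between integers. Then $\phi$ is not a coboundary, i.e. $\phi\notin B^2_{\rm TQ}(R_n;R_\infty)$.
   Context: Let $\Lambda=\mathbb{Z}[T,T^{-1}]$. A quandle is a set with a binary operation $*$ such that $a*a=a$ for all $a$; for all $a,b$ there is a unique $c$ with $a=c*b$; and $(a*b)*c=(a*c)*(b*c)$ for all $a,b,c$. $R_\infty$ is the quandle $\mathbb{Z}$ with $a*b=2b-a$, and the dihedral quandle $R_n$ is $\mathbb{Z}_n=\mathbb{Z}/n\mathbb{Z}$ with $a*b=2b-a\pmod n$. As a coefficient group, $R_\infty$ is regarded as the $\Lambda$-module $\mathbb{Z}$ on which $T$ acts as multiplication by $-1$. For a quandle $X$ and a $\Lambda$-module $A$, $Z^2_{\rm TQ}(X;A)$ is the group of functions $\phi:X\times X\to A$ with $\phi(x,x)=0$ for all $x$ and $$T\phi(x_1,x_2)+\phi(x_1*x_2,x_3)=T\phi(x_1,x_3)+(1-T)\phi(x_2,x_3)+\phi(x_1*x_3,x_2*x_3)$$ for all $x_1,x_2,x_3\in X$. $B^2_{\rm TQ}(X;A)$ is the subgroup of functions of the form $(x_1,x_2)\mapsto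 T\eta(x_1)+(1-T)\eta(x_2)-\eta(x_1*x_2)$ for an arbitrary function $\eta:X\to A$.
   Formalization: The formal statement assumes n ≥ 2 instead of n positive: for n = 1 the cocycle is identically zero and hence a coboundary, so the claim fails there. That φ is a cocycle is proved rather than assumed. *)

theory Defs
  imports HOL.Modules "HOL-Library.Poly_Mapping" "HOL-Library.FuncSet"
begin

locale quandle =
  fixes X :: "'a set" and op :: "'a \<Rightarrow> 'a \<Rightarrow> 'a"
  assumes closed: "a \<in> X \<Longrightarrow> b \<in> X \<Longrightarrow> op a b \<in> X"
    and idem: "a \<in> X \<Longrightarrow> op a a = a"
    and right_div: "a \<in> X \<Longrightarrow> b \<in> X \<Longrightarrow> \<exists>!c. c \<in> X \<and> a = op c b"
    and right_distrib:
      "a \<in> X \<Longrightarrow> b \<in> X \<Longrightarrow> c \<in> X \<Longrightarrow> op (op a b) c = op (op a c) (op b c)"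

(* Finitely supported functions int => int; the multiplication of poly_mapping is the
   convolution over the additive group int, so this is the ring Z[T, T^-1]. *)
type_synonym laurent = "int \<Rightarrow>\<^sub>0 int"

definition T :: laurent where
  "T = Poly_Mapping.single 1 1"

lemma T_unit: "T * Poly_Mapping.single (- 1) 1 = 1"
  by (simp add: T_def mult_single)

(* In both definitions below X (with op) is a quandle, and the type 'm with scalar
   multiplication smult is a module over laurent.  Functions on X \<times> X are made
   extensional, so that they are determined by their values on X \<times> X. *)
definition Z2_TQ ::
  "'a set \<Rightarrow> ('a \<Rightarrow> 'a \<Rightarrow> 'a) \<Rightarrow> (laurent \<Rightarrow> 'm \<Rightarrow> 'm) \<Rightarrow> ('a \<times> 'a \<Rightarrow> 'm::ab_group_add) set" where
  "Z2_TQ X op smult = {\<phi> \<in> extensional (X \<times> X).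
     (\<forall>x\<in>X. \<phi> (x, x) = 0) \<and>
     (\<forall>x1\<in>X. \<forall>x2\<in>X. \<forall>x3\<in>X.
        smult T (\<phi> (x1, x2)) + \<phi> (op x1 x2, x3) =
        smult T (\<phi> (x1, x3)) + smult (1 - T) (\<phi> (x2, x3)) + \<phi> (op x1 x3, op x2 x3))}"

definition B2_TQ ::
  "'a set \<Rightarrow> ('a \<Rightarrow> 'a \<Rightarrow> 'a) \<Rightarrow> (laurent \<Rightarrow> 'm \<Rightarrow> 'm) \<Rightarrow> ('a \<times> 'a \<Rightarrow> 'm::ab_group_add) set" where
  "B2_TQ X op smult =
     {restrict (\<lambda>(x1, x2). smult T (\<eta> x1) + smult (1 - T) (\<eta> x2) - \<eta> (op x1 x2)) (X \<times> X) | \<eta>. True}"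

definition R_carrier :: "int \<Rightarrow> int set" where
  "R_carrier n = {0..<n}"

definition R_op :: "int \<Rightarrow> int \<Rightarrow> int \<Rightarrow> int" where
  "R_op n a b = (2 * b - a) mod n"

definition Rinf_op :: "int \<Rightarrow> int \<Rightarrow> int" where
  "Rinf_op a b = 2 * b - a"

(* The module structure on int in which T acts as -1: a Laurent polynomial acts
   through its value at T = -1. *)
definition Rinf_smult :: "laurent \<Rightarrow> int \<Rightarrow> int" where
  "Rinf_smult p k = (\<Sum>i\<in>Poly_Mapping.keys p. Poly_Mapping.lookup p i * (if even i then 1 else - 1)) * k"

definition dihedral_cocycle :: "int \<Rightarrow> int \<times> int \<Rightarrow> int" where
  "dihedral_cocycle n = restrict (\<lambda>(a, b).
     if 2 * b < a then - 1
     else if 2 * b < n + a \<and> a \<le> 2 * b then 0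
     else 1) (R_carrier n \<times> R_carrier n)"


lemma quandle_R: "n > 0 \<Longrightarrow> quandle (R_carrier n) (R_op n)"
proof
  fix a b :: int
  assume n: "n > 0" and ab: "a \<in> R_carrier n" "b \<in> R_carrier n"
  show "R_op n a b \<in> R_carrier n"
    using n by (simp add: R_op_def R_carrier_def)
  show "\<exists>!c. c \<in> R_carrier n \<and> a = R_op n c b"
  proof (rule ex1I[of _ "R_op n a b"])
    have "(2 * b - (2 * b - a) mod n) mod n = a mod n"
      by (simp add: mod_diff_right_eq)
    then show "R_op n a b \<in> R_carrier n \<and> a = R_op n (R_op n a b) b"
      using n ab by (simp add: R_op_def R_carrier_def)
  next
    fix c assume c: "c \<in> R_carrier n \<and> a = R_op n c b"
    have "(2 * b - (2 * b - c) mod n) mod n = c mod n"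
      by (simp add: mod_diff_right_eq)
    then show "c = R_op n a b"
      using c by (simp add: R_op_def R_carrier_def)
  qed
next
  fix a :: int assume "a \<in> R_carrier n"
  then show "R_op n a a = a" by (simp add: R_op_def R_carrier_def)
next
  fix a b c :: int
  have "(2 * c - (2 * b - a)) mod n = (2 * (2 * c - b) - (2 * c - a)) mod n"
    by (simp add: algebra_simps)
  also have "\<dots> = (2 * ((2 * c - b) mod n) - (2 * c - a) mod n) mod n"
    by (metis mod_diff_left_eq mod_diff_right_eq mod_mult_right_eq)
  finally show "R_op n (R_op n a b) c = R_op n (R_op n a c) (R_op n b c)"
    by (simp add: R_op_def mod_diff_right_eq)
qed

lemma quandle_Rinf: "quandle UNIV Rinf_op"
proof
  fix a b :: int
  show "\<exists>!c. c \<in> UNIV \<and> a = Rinf_op c b"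
    by (rule ex1I[of _ "2 * b - a"]) (auto simp: Rinf_op_def)
qed (auto simp: Rinf_op_def)

lemma Rinf_smult_add: "Rinf_smult (p + q) k = Rinf_smult p k + Rinf_smult q k"
proof -
  have "(\<Sum>i\<in>Poly_Mapping.keys (p + q). Poly_Mapping.lookup (p + q) i * (if even i then 1 else - 1 :: int)) =
      (\<Sum>i\<in>Poly_Mapping.keys p. Poly_Mapping.lookup p i * (if even i then 1 else - 1)) +
      (\<Sum>i\<in>Poly_Mapping.keys q. Poly_Mapping.lookup q i * (if even i then 1 else - 1))"
    by (rule setsum_keys_plus_distrib) (auto simp: algebra_simps)
  then show ?thesis by (simp add: Rinf_smult_def distrib_right)
qed

lemma Rinf_smult_single:
  "Rinf_smult (Poly_Mapping.single i c) k = (if even i then c * k else - (c * k))"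
  by (simp add: Rinf_smult_def)

lemma laurent_induct:
  fixes p :: laurent
  assumes "P 0" and "\<And>p i c. P p \<Longrightarrow> P (p + Poly_Mapping.single i c)"
  shows "P p"
proof (induction p rule: update_induct)
  case const
  then show ?case using assms(1) by simp
next
  case (update p i c)
  have "Poly_Mapping.update i c p = p + Poly_Mapping.single i c"
    using update by (intro poly_mapping_eqI) (auto simp: lookup_update lookup_add lookup_single in_keys_iff when_def)
  then show ?case using assms(2) update by simp
qed

lemma module_Rinf: "module Rinf_smult"
proof
  fix p q :: laurent and j k :: int
  have add: "Rinf_smult r (j + k) = Rinf_smult r j + Rinf_smult r k" for r j k
    by (simp add: Rinf_smult_def distrib_left)
  have zero: "Rinf_smult 0 k = 0" "Rinf_smult r 0 = 0" for k r
    by (simp_all add: Rinf_smult_def)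
  show "Rinf_smult p (j + k) = Rinf_smult p j + Rinf_smult p k" by (rule add)
  show "Rinf_smult (p + q) k = Rinf_smult p k + Rinf_smult q k" by (rule Rinf_smult_add)
  show "Rinf_smult 1 k = k"
    by (simp add: Rinf_smult_single flip: single_one)
  have single: "Rinf_smult (Poly_Mapping.single i c) (Rinf_smult q k) =
      Rinf_smult (Poly_Mapping.single i c * q) k" for i c
    by (induction q rule: laurent_induct)
       (auto simp: zero add Rinf_smult_add distrib_left mult_single Rinf_smult_single)
  show "Rinf_smult p (Rinf_smult q k) = Rinf_smult (p * q) k"
    by (induction p rule: laurent_induct)
       (simp_all add: zero Rinf_smult_add distrib_right single)
qed

lemma Rinf_smult_T: "Rinf_smult T k = - k"
  by (simp add: T_def Rinf_smult_single)

lemma Rinf_smult_1_minus_T: "Rinf_smult (1 - T) k = 2 * k"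
  using module.scale_left_diff_distrib[OF module_Rinf, of 1 T k] module.scale_one[OF module_Rinf]
  by (simp add: Rinf_smult_T)

lemma Rinf_op_alexander: "Rinf_op a b = Rinf_smult T a + Rinf_smult (1 - T) b"
  by (simp add: Rinf_op_def Rinf_smult_T Rinf_smult_1_minus_T)

(* For n = 1 the cocycle is zero, hence a coboundary: non-triviality needs n >= 2. *)
lemma dihedral_cocycle_1: "dihedral_cocycle 1 \<in> B2_TQ (R_carrier 1) (R_op 1) Rinf_smult"
proof -
  have "dihedral_cocycle 1 =
      restrict (\<lambda>(x1, x2). Rinf_smult T 0 + Rinf_smult (1 - T) 0 - 0) (R_carrier 1 \<times> R_carrier 1)"
    by (rule extensionalityI[of _ "R_carrier 1 \<times> R_carrier 1"])
       (auto simp: dihedral_cocycle_def R_carrier_def Rinf_smult_def)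
  then show ?thesis unfolding B2_TQ_def by (intro CollectI exI[of _ "\<lambda>_. 0"]) simp
qed

end

theory Submission
  imports Defs
begin

text \<open>
  For representatives \<open>a, b \<in> {0..<n}\<close> the three cases in the definition of the cocycle
  \<open>\<phi>\<close> say that \<open>\<phi>(a, b)\<close> is the quotient \<open>\<lfloor>(2b - a) / n\<rfloor>\<close>. As \<open>a * b\<close> is the remainder of
  the same division, \<open>n \<phi>(a, b) = 2b - a - a * b\<close>: the multiple \<open>n \<phi>\<close> is the coboundary of
  the inclusion of \<open>{0..<n}\<close> into the integers. Multiplying the cocycle condition by \<open>n\<close>
  reduces it to right self-distributivity of \<open>R_n\<close>.

  If \<open>\<phi>\<close> were the coboundary of \<open>\<eta>\<close>, then \<open>g(x) = n \<eta>(x) - x\<close> would have zero coboundary,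
  that is, \<open>g\<close> would be a quandle homomorphism from \<open>R_n\<close> to \<open>R_\<infinity>\<close>. Such a homomorphism on
  a finite quandle is constant, by the maximum principle \<open>hom_finite_to_Rinf_constant\<close>. Comparing the values at
  \<open>0\<close> and \<open>1\<close> gives \<open>n (\<eta>(1) - \<eta>(0)) = 1\<close>, which is impossible for \<open>n \<ge> 2\<close>.
\<close>

lemma dihedral_cocycle_eq_div:
  assumes "a \<in> R_carrier n" and "b \<in> R_carrier n"
  shows "dihedral_cocycle n (a, b) = (2 * b - a) div n"
proof -
  have n: "0 < n" and ab: "0 \<le> a" "a < n" "0 \<le> b" "b < n"
    using assms by (auto simp: R_carrier_def)
  consider "2 * b < a" | "a \<le> 2 * b" "2 * b < n + a" | "n + a \<le> 2 * b"
    by linarith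
  then show ?thesis
  proof cases
    case 1
    have "(2 * b - a) div n = - 1"
      using n ab 1 by (intro int_div_pos_eq[where r = "2 * b - a + n"]) auto
    with 1 assms show ?thesis by (simp add: dihedral_cocycle_def)
  next
    case 2
    then have "(2 * b - a) div n = 0"
      by (intro div_pos_pos_trivial) auto
    with 2 assms show ?thesis by (simp add: dihedral_cocycle_def)
  next
    case 3
    have "(2 * b - a) div n = 1"
      using n ab 3 by (intro int_div_pos_eq[where r = "2 * b - a - n"]) auto
    with 3 n ab assms show ?thesis by (simp add: dihedral_cocycle_def)
  qed
qed

lemma n_times_dihedral_cocycle:
  assumes "a \<in> R_carrier n" and "b \<in> R_carrier n"
  shows "n * dihedral_cocycle n (a, b) = 2 * b - a - R_op n a b"
  using assms by (simp add: dihedral_cocycle_eq_div R_op_def minus_mod_eq_mult_div)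

lemma dihedral_cocycle_in_Z2_TQ:
  assumes n: "n > 0"
  shows "dihedral_cocycle n \<in> Z2_TQ (R_carrier n) (R_op n) Rinf_smult"
proof -
  interpret quandle "R_carrier n" "R_op n"
    using n by (rule quandle_R)
  let ?\<phi> = "dihedral_cocycle n"
  have "?\<phi> \<in> extensional (R_carrier n \<times> R_carrier n)"
    by (simp add: dihedral_cocycle_def)
  moreover have "?\<phi> (x, x) = 0" if x: "x \<in> R_carrier n" for x
    using n_times_dihedral_cocycle[OF x x] idem[OF x] n by simp
  moreover have "- ?\<phi> (x, y) + ?\<phi> (R_op n x y, z) =
      - ?\<phi> (x, z) + 2 * ?\<phi> (y, z) + ?\<phi> (R_op n x z, R_op n y z)"
    if xyz: "x \<in> R_carrier n" "y \<in> R_carrier n" "z \<in> R_carrier n" for x y z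
  proof -
    have "n * (- ?\<phi> (x, y) + ?\<phi> (R_op n x y, z)) =
        n * (- ?\<phi> (x, z) + 2 * ?\<phi> (y, z) + ?\<phi> (R_op n x z, R_op n y z))"
      using xyz n_times_dihedral_cocycle[of x n y] n_times_dihedral_cocycle[of "R_op n x y" n z]
        n_times_dihedral_cocycle[of x n z] n_times_dihedral_cocycle[of y n z]
        n_times_dihedral_cocycle[of "R_op n x z" n "R_op n y z"] right_distrib[of x y z]
      by (simp add: closed algebra_simps)
    with n show ?thesis by simp
  qed
  ultimately show ?thesis
    by (simp add: Z2_TQ_def Rinf_smult_T Rinf_smult_1_minus_T)
qed

text \<open>
  If \<open>g\<close> is maximal at \<open>m\<close>, then \<open>2 g(m) - g(x) = g(x * m) \<le> g(m)\<close>, so \<open>g(x) \<ge> g(m)\<close> for every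
  \<open>x\<close>. Closure under the operation is the only property of a quandle that is needed.
\<close>

lemma hom_finite_to_Rinf_constant:
  fixes g :: "'a \<Rightarrow> int"
  assumes fin: "finite X"
    and closed: "\<And>x y. x \<in> X \<Longrightarrow> y \<in> X \<Longrightarrow> op x y \<in> X"
    and hom: "\<And>x y. x \<in> X \<Longrightarrow> y \<in> X \<Longrightarrow> g (op x y) = Rinf_op (g x) (g y)"
    and "x \<in> X" and "y \<in> X"
  shows "g x = g y"
proof -
  have "Max (g ` X) \<in> g ` X"
    using fin \<open>x \<in> X\<close> by (intro Max_in) auto
  then obtain m where m: "m \<in> X" and "g m = Max (g ` X)"
    by auto
  with fin have le: "g z \<le> g m" if "z \<in> X" for z
    using that by simp
  have "g z = g m" if z: "z \<in> X" for z
    using le[OF z] le[OF closed[OF z m]] hom[OF z m] by (simp add: Rinf_op_def)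
  with \<open>x \<in> X\<close> \<open>y \<in> X\<close> show ?thesis by simp
qed

theorem proposition5p7:
  fixes n :: int
  assumes "n \<ge> 2"
  shows "dihedral_cocycle n \<in> Z2_TQ (R_carrier n) (R_op n) Rinf_smult \<and>
         dihedral_cocycle n \<notin> B2_TQ (R_carrier n) (R_op n) Rinf_smult"
proof
  show "dihedral_cocycle n \<in> Z2_TQ (R_carrier n) (R_op n) Rinf_smult"
    using assms by (intro dihedral_cocycle_in_Z2_TQ) simp
  show "dihedral_cocycle n \<notin> B2_TQ (R_carrier n) (R_op n) Rinf_smult"
  proof
    assume "dihedral_cocycle n \<in> B2_TQ (R_carrier n) (R_op n) Rinf_smult"
    then obtain \<eta> where \<eta>: "dihedral_cocycle n = restrict (\<lambda>(x, y). Rinf_smult T (\<eta> x) +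
        Rinf_smult (1 - T) (\<eta> y) - \<eta> (R_op n x y)) (R_carrier n \<times> R_carrier n)"
      by (auto simp: B2_TQ_def)
    interpret quandle "R_carrier n" "R_op n"
      using assms by (intro quandle_R) simp
    define g where "g x = n * \<eta> x - x" for x
    have "g (R_op n x y) = Rinf_op (g x) (g y)"
      if xy: "x \<in> R_carrier n" "y \<in> R_carrier n" for x y
    proof -
      have "n * (2 * \<eta> y - \<eta> x - \<eta> (R_op n x y)) = 2 * y - x - R_op n x y"
        using n_times_dihedral_cocycle[OF xy] xy
        by (simp add: \<eta> Rinf_smult_T Rinf_smult_1_minus_T)
      then show ?thesis
        by (simp add: g_def Rinf_op_def algebra_simps)
    qed
    then have "g 0 = g 1"
      using assms closed
      by (intro hom_finite_to_Rinf_constant[of "R_carrier n" "R_op n" g])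
        (auto simp: R_carrier_def)
    then have "n * (\<eta> 1 - \<eta> 0) = 1"
      by (simp add: g_def algebra_simps)
    then have "n dvd 1"
      by (metis dvd_triv_left)
    with assms show False by simp
  qed
qed

end
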